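(* Let $G$ be a finite simple graph with $n\ge3$ vertices and $m$ edges. For each $i$ let $n_i$ be the number of vertices of degree $i$, and let $\delta,\Delta$ be the minimum and maximum degree. Assume $\Delta\ge3$, $\Delta-\delta>1$, and $2m-n\delta=q(\Delta-\delta)+r$ where $q$ is a positive integer and $r$ is an integer with $0\le r\le\Delta-\delta-1$. Let $\alpha\in\mathbb{R}$, $\alpha\notin\{0,1\}$ (when $\alpha<0$ assume $\delta\ge1$), and $s_\alpha=\frac{\Delta^\alpha-\delta^\alpha}{\Delta-\delta}$. Then: (1) If $r=0$ and $n_\Delta=q$, then every vertex of $G$ has degree $\delta$ or $\Delta$. (2) If $r\ge1$ and $n_\Delta=q$, then $n_i=0$ for $\delta+r+1\le i\le\Delta-1$ and $n_{\delta+r}\le1$. (3) If $r\ge1$, $n_{\delta+r}\ne0$, and ($\alpha<0$ or $\alpha>1$), then $M_1^\alpha(G)\le n\delta^\alpha+(2m-n\delta)s_\alpha+(\delta+r)^\alpha-\delta^\alpha-rs_\alpha$. (4) If $r\ge1$, $n_{\delta+r}\ne0$, and $0<\alpha<1$, then $M_1^\alpha(G)\ge n\delta^\alpha+(2m-n\delta)s_\alpha+(\delta+r)^\alpha-\delta^\alpha-rs_\alpha$. In (3) and (4), equality holds if $G$ has $q$ vertices of degree $\Delta$, exactly one vertex of degree $\delta+r$, and $n-q-1$ vertices of degree $\delta$.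
   Context: For a graph $G$ with vertex set $V(G)$ and vertex degrees $d(u)$, the general first Zagreb index is $M_1^\alpha(G)=\sum_{u\in V(G)}d(u)^\alpha$. *)

theory Defs
  imports Complex_Main "Graph_Theory.Digraph"
begin

text \<open>
  A finite simple graph is an instance of the locale \<open>graph\<close> of \<open>Graph_Theory\<close>: a finite,
  loop-free, symmetric digraph without parallel arcs. Each undirected edge \<open>{u, v}\<close> is then
  represented by the two arcs from \<open>u\<close> to \<open>v\<close> and from \<open>v\<close> to \<open>u\<close>.
\<close>

definition undirected_edges :: "('a, 'b) pre_digraph \<Rightarrow> 'a set set" where
  "undirected_edges G = (\<lambda>e. {tail G e, head G e}) ` arcs G"

definition vertex_degree :: "('a, 'b) pre_digraph \<Rightarrow> 'a \<Rightarrow> nat" where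
  "vertex_degree G u = card {e \<in> undirected_edges G. u \<in> e}"

definition num_of_degree :: "('a, 'b) pre_digraph \<Rightarrow> nat \<Rightarrow> nat" where
  "num_of_degree G i = card {u \<in> verts G. vertex_degree G u = i}"

definition min_degree :: "('a, 'b) pre_digraph \<Rightarrow> nat" where
  "min_degree G = Min (vertex_degree G ` verts G)"

definition max_degree :: "('a, 'b) pre_digraph \<Rightarrow> nat" where
  "max_degree G = Max (vertex_degree G ` verts G)"

text \<open>
  The general first Zagreb index. Since \<open>0 powr \<alpha> = 0\<close>, isolated vertices contribute \<open>0\<close>, which
  is the usual value \<open>0\<^sup>\<alpha>\<close> for \<open>\<alpha> > 0\<close>; for \<open>\<alpha> \<le> 0\<close> the definition is meaningful only if there
  are no isolated vertices.
\<close>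

definition general_first_zagreb :: "real \<Rightarrow> ('a, 'b) pre_digraph \<Rightarrow> real" where
  "general_first_zagreb \<alpha> G = (\<Sum>u\<in>verts G. real (vertex_degree G u) powr \<alpha>)"

end

theory Submission
  imports Defs "HOL-Analysis.Convex"
begin

text \<open>
  Write \<open>g(d) = d\<^sup>\<alpha> - \<delta>\<^sup>\<alpha> - (d - \<delta>) s\<close> for the height of the power function over its chord on
  \<open>[\<delta>, \<Delta>]\<close>. The handshake lemma gives \<open>\<Sum>\<^sub>u g(d(u)) = M\<^sub>1\<^sup>\<alpha>(G) - n \<delta>\<^sup>\<alpha> - (2 m - n \<delta>) s\<close>, and \<open>g\<close> has
  constant sign on \<open>[\<delta>, \<Delta>]\<close> by convexity or concavity, so the sum is bounded by the single term
  of a vertex of degree \<open>\<delta> + r\<close>. Since \<open>g(\<delta>) = g(\<Delta>) = 0\<close>, the extremal degree sequence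
  attains the bound. Moreover the excesses \<open>d(u) - \<delta>\<close> add up to \<open>q (\<Delta> - \<delta>) + r\<close>; if exactly \<open>q\<close> vertices
  have degree \<open>\<Delta>\<close>, only a total excess of \<open>r\<close> is left for the others.
\<close>

text \<open>Double counting of incidences: a simple graph has no loops, so each edge, as a set,
  contains exactly two vertices.\<close>

lemma (in graph) handshake:
  "(\<Sum>u\<in>verts G. vertex_degree G u) = 2 * card (undirected_edges G)"
  unfolding vertex_degree_def
proof (rule sum_multicount)
  show "finite (undirected_edges G)"
    by (simp add: undirected_edges_def)
  show "\<forall>e\<in>undirected_edges G. card {u \<in> verts G. u \<in> e} = 2"
  proof
    fix e assume "e \<in> undirected_edges G"
    then obtain a where a: "a \<in> arcs G" and e: "e = {tail G a, head G a}"
      by (auto simp: undirected_edges_def)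
    have "{u \<in> verts G. u \<in> e} = {tail G a, head G a}"
      using a e by auto
    then show "card {u \<in> verts G. u \<in> e} = 2"
      using no_loops[OF a] by simp
  qed
qed simp

lemma has_second_derivative_powr:
  fixes p x :: real
  assumes "x > 0"
  shows "((\<lambda>x. x powr p) has_real_derivative p * x powr (p - 1)) (at x)"
    and "((\<lambda>x. p * x powr (p - 1)) has_real_derivative p * (p - 1) * x powr (p - 2)) (at x)"
  using assms by (auto intro!: derivative_eq_intros)

text \<open>The factors \<open>p\<close> and \<open>p - 1\<close> have the same sign, so the second
  derivative is nonnegative. The point 0 is left out because the convention
  \<open>0 powr p = 0\<close> destroys convexity there for \<open>p < 0\<close>.\<close>

lemma convex_on_powr:
  fixes p :: real
  assumes "p < 0 \<or> p > 1"
  shows "convex_on {0<..} (\<lambda>x. x powr p)"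
proof (rule f''_ge0_imp_convex[OF _ has_second_derivative_powr])
  have "0 \<le> p * (p - 1)"
    using assms by (auto simp: zero_le_mult_iff)
  then show "0 \<le> p * (p - 1) * x powr (p - 2)" for x
    by simp
qed auto

lemma concave_on_powr:
  fixes p :: real
  assumes "0 < p" "p < 1"
  shows "concave_on {0<..} (\<lambda>x. x powr p)"
proof (rule f''_le0_imp_concave[OF _ has_second_derivative_powr])
  have "p * (p - 1) \<le> 0"
    using assms by (auto simp: mult_le_0_iff)
  then show "p * (p - 1) * x powr (p - 2) \<le> 0" for x
    by (simp add: mult_nonpos_nonneg)
qed auto

text \<open>Convexity puts the graph below its chord when \<open>a > 0\<close>. The left end
  \<open>a = 0\<close>, which allows for isolated vertices, lies outside the domain of
  \<open>convex_on_powr\<close> and is treated by hand.\<close>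

lemma powr_le_chord:
  fixes a b p x :: real
  assumes "p < 0 \<or> p > 1" "p < 0 \<longrightarrow> a > 0" "0 \<le> a" "a < b" "x \<in> {a..b}"
  shows "x powr p \<le> (b powr p - a powr p) / (b - a) * (x - a) + a powr p"
proof (cases "a = 0")
  case True
  then have "p > 1" "0 \<le> x" "x \<le> b" "b > 0"
    using assms by auto
  \<comment> \<open>The chord from the origin has slope \<open>b powr (p - 1)\<close>, so the claim
    reduces to monotonicity of the power with exponent \<open>p - 1 > 0\<close>.\<close>
  then have "x * x powr (p - 1) \<le> x * b powr (p - 1)"
    by (intro mult_left_mono powr_mono2) auto
  then show ?thesis
    using True \<open>0 \<le> x\<close> \<open>b > 0\<close> by (cases "x = 0") (auto simp: powr_diff mult.commute)
next
  case False
  have "convex_on {a..b} (\<lambda>x. x powr p)"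
    using convex_on_powr[OF assms(1)] False assms(3) by (rule_tac convex_on_subset) auto
  then show ?thesis
    using convex_onD_Icc' assms(5) by blast
qed

lemma powr_ge_chord:
  fixes a b p x :: real
  assumes "0 < p" "p < 1" "0 \<le> a" "a < b" "x \<in> {a..b}"
  shows "(b powr p - a powr p) / (b - a) * (x - a) + a powr p \<le> x powr p"
proof (cases "a = 0")
  case True
  show ?thesis
  proof (cases "x = 0")
    case False
    then have "0 < x" "x \<le> b" "b > 0"
      using True assms by auto
    \<comment> \<open>Here \<open>p - 1\<close> is negative, so the power decreases, but only on
      positive arguments; hence the separate case \<open>x = 0\<close>.\<close>
    then have "x * b powr (p - 1) \<le> x * x powr (p - 1)"
      using assms by (intro mult_left_mono powr_mono2') auto
    then show ?thesis
      using True \<open>0 < x\<close> \<open>b > 0\<close> by (auto simp: powr_diff mult.commute)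
  qed (use True in auto)
next
  case False
  have "convex_on {a..b} (\<lambda>x. - (x powr p))"
    using concave_on_powr[OF assms(1,2)] False assms(3) unfolding concave_on_def
    by (rule_tac convex_on_subset) auto
  then have "concave_on {a..b} (\<lambda>x. x powr p)"
    by (simp add: concave_on_def)
  then show ?thesis
    using concave_onD_Icc' assms(5) by blast
qed

theorem theorem3p5:
  fixes G :: "('a, 'b) pre_digraph"
    and n m \<delta> \<Delta> q r :: nat
    and \<alpha> s :: real
  assumes "graph G"
    and "n = card (verts G)" and "n \<ge> 3"
    and "m = card (undirected_edges G)"
    and "\<delta> = min_degree G" and "\<Delta> = max_degree G"
    and "\<Delta> \<ge> 3" and "int \<Delta> - int \<delta> > 1"
    and "2 * int m - int n * int \<delta> = int q * (int \<Delta> - int \<delta>) + int r"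
    and "q > 0" and "int r \<le> int \<Delta> - int \<delta> - 1"
    and "\<alpha> \<noteq> 0" and "\<alpha> \<noteq> 1" and "\<alpha> < 0 \<longrightarrow> \<delta> \<ge> 1"
    and "s = (real \<Delta> powr \<alpha> - real \<delta> powr \<alpha>) / (real \<Delta> - real \<delta>)"
  shows
    "(r = 0 \<and> num_of_degree G \<Delta> = q \<longrightarrow>
        (\<forall>u\<in>verts G. vertex_degree G u = \<delta> \<or> vertex_degree G u = \<Delta>)) \<and>
     (r \<ge> 1 \<and> num_of_degree G \<Delta> = q \<longrightarrow>
        (\<forall>i. \<delta> + r + 1 \<le> i \<and> i \<le> \<Delta> - 1 \<longrightarrow> num_of_degree G i = 0) \<and>
        num_of_degree G (\<delta> + r) \<le> 1) \<and>
     (r \<ge> 1 \<and> num_of_degree G (\<delta> + r) \<noteq> 0 \<and> (\<alpha> < 0 \<or> \<alpha> > 1) \<longrightarrow>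
        general_first_zagreb \<alpha> G
          \<le> real n * real \<delta> powr \<alpha> + (2 * real m - real n * real \<delta>) * s
             + real (\<delta> + r) powr \<alpha> - real \<delta> powr \<alpha> - real r * s \<and>
        (num_of_degree G \<Delta> = q \<and> num_of_degree G (\<delta> + r) = 1 \<and>
         int (num_of_degree G \<delta>) = int n - int q - 1 \<longrightarrow>
           general_first_zagreb \<alpha> G
             = real n * real \<delta> powr \<alpha> + (2 * real m - real n * real \<delta>) * s
                + real (\<delta> + r) powr \<alpha> - real \<delta> powr \<alpha> - real r * s)) \<and>
     (r \<ge> 1 \<and> num_of_degree G (\<delta> + r) \<noteq> 0 \<and> 0 < \<alpha> \<and> \<alpha> < 1 \<longrightarrow>
        general_first_zagreb \<alpha> G
          \<ge> real n * real \<delta> powr \<alpha> + (2 * real m - real n * real \<delta>) * s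
             + real (\<delta> + r) powr \<alpha> - real \<delta> powr \<alpha> - real r * s \<and>
        (num_of_degree G \<Delta> = q \<and> num_of_degree G (\<delta> + r) = 1 \<and>
         int (num_of_degree G \<delta>) = int n - int q - 1 \<longrightarrow>
           general_first_zagreb \<alpha> G
             = real n * real \<delta> powr \<alpha> + (2 * real m - real n * real \<delta>) * s
                + real (\<delta> + r) powr \<alpha> - real \<delta> powr \<alpha> - real r * s))"
proof -
  interpret graph G by fact
  define V where "V = verts G"
  define d where "d = vertex_degree G"
  define g where "g x = x powr \<alpha> - real \<delta> powr \<alpha> - (x - real \<delta>) * s" for x :: real
  define B where "B = real n * real \<delta> powr \<alpha> + (2 * real m - real n * real \<delta>) * s
             + real (\<delta> + r) powr \<alpha> - real \<delta> powr \<alpha> - real r * s"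
  have fin: "finite V"
    by (simp add: V_def)
  have N: "num_of_degree G i = card {u \<in> V. d u = i}" for i
    by (simp add: num_of_degree_def V_def d_def)
  have \<delta>: "\<delta> \<le> d u" and \<Delta>: "d u \<le> \<Delta>" if "u \<in> V" for u
    using that fin by (simp_all add: assms min_degree_def max_degree_def V_def d_def)
  have degsum: "(\<Sum>u\<in>V. d u) = 2 * m"
    using handshake by (simp add: V_def d_def assms)
  have less: "\<delta> < \<Delta>" and r: "\<delta> + r < \<Delta>"
    using assms(8,11) by linarith+

  \<comment> \<open>Subtraction of naturals truncates; \<delta> being the minimum degree makes each
    excess a true difference.\<close>
  have "int (\<Sum>u\<in>V. d u - \<delta>) = (\<Sum>u\<in>V. int (d u) - int \<delta>)"
    using \<delta> by (simp add: of_nat_diff)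
  also have "\<dots> = 2 * int m - int n * int \<delta>"
    using arg_cong[OF degsum, of int] by (simp add: sum_subtractf assms(2) V_def)
  also have "\<dots> = int (q * (\<Delta> - \<delta>) + r)"
    using assms(9) less by (simp add: of_nat_diff)
  finally have excess: "(\<Sum>u\<in>V. d u - \<delta>) = q * (\<Delta> - \<delta>) + r"
    by linarith
  have rest: "(\<Sum>u\<in>{u\<in>V. d u \<noteq> \<Delta>}. d u - \<delta>) = r" if "num_of_degree G \<Delta> = q"
  proof -
    have "(\<Sum>u\<in>V. d u - \<delta>) = (\<Sum>u\<in>{u\<in>V. d u = \<Delta>}. d u - \<delta>) + (\<Sum>u\<in>{u\<in>V. d u \<noteq> \<Delta>}. d u - \<delta>)"
      using fin by (subst sum.union_disjoint[symmetric]) (auto intro: sum.cong)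
    also have "(\<Sum>u\<in>{u\<in>V. d u = \<Delta>}. d u - \<delta>) = q * (\<Delta> - \<delta>)"
      using that by (simp add: N)
    finally show ?thesis
      using excess by simp
  qed

  have part1: "d u = \<delta> \<or> d u = \<Delta>" if "r = 0" "num_of_degree G \<Delta> = q" "u \<in> V" for u
  proof -
    have "d u - \<delta> = 0" if "d u \<noteq> \<Delta>"
      using rest \<open>r = 0\<close> \<open>num_of_degree G \<Delta> = q\<close> \<open>u \<in> V\<close> that fin by auto
    then show ?thesis
      using \<delta>[OF \<open>u \<in> V\<close>] by fastforce
  qed
  have part2a: "num_of_degree G i = 0"
    if "num_of_degree G \<Delta> = q" "\<delta> + r + 1 \<le> i" "i \<le> \<Delta> - 1" for i
  proof -
    have "d u \<noteq> i" if "u \<in> V" for u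
    proof
      assume "d u = i"
      \<comment> \<open>This one vertex would already have an excess of at least
        \<open>r + 1\<close>, more than the total \<open>r\<close>.\<close>
      then have "d u - \<delta> \<le> (\<Sum>u\<in>{u\<in>V. d u \<noteq> \<Delta>}. d u - \<delta>)"
        using \<open>u \<in> V\<close> fin \<open>i \<le> \<Delta> - 1\<close> less by (intro member_le_sum) auto
      then show False
        using rest \<open>num_of_degree G \<Delta> = q\<close> \<open>\<delta> + r + 1 \<le> i\<close> \<open>d u = i\<close> by simp
    qed
    then show ?thesis
      by (auto simp: N card_eq_0_iff)
  qed
  have part2b: "num_of_degree G (\<delta> + r) \<le> 1" if "r \<ge> 1" "num_of_degree G \<Delta> = q"
  proof -
    \<comment> \<open>With \<open>k\<close> vertices of degree \<open>\<delta> + r\<close> this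
      reads \<open>k * r \<le> r\<close>, and \<open>r \<ge> 1\<close> can be cancelled.\<close>
    have "(\<Sum>u\<in>{u\<in>V. d u = \<delta> + r}. d u - \<delta>) \<le> (\<Sum>u\<in>{u\<in>V. d u \<noteq> \<Delta>}. d u - \<delta>)"
      using fin r by (intro sum_mono2) auto
    then show ?thesis
      using rest that by (simp add: N)
  qed

  have "(\<Sum>u\<in>V. g (real (d u)))
      = general_first_zagreb \<alpha> G - real n * real \<delta> powr \<alpha> - ((\<Sum>u\<in>V. real (d u)) - real n * real \<delta>) * s"
    by (simp add: g_def general_first_zagreb_def sum_subtractf assms(2) V_def d_def
        flip: sum_distrib_right)
  also have "(\<Sum>u\<in>V. real (d u)) = 2 * real m"
    using arg_cong[OF degsum, of real] by simp
  \<comment> \<open>The last four terms of \<open>B\<close> are exactly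
    \<open>g (real (\<delta> + r))\<close>.\<close>
  finally have zagreb: "general_first_zagreb \<alpha> G - B = (\<Sum>u\<in>V. g (real (d u))) - g (real (\<delta> + r))"
    by (simp add: B_def g_def)

  have zero: "g (real \<delta>) = 0" "g (real \<Delta>) = 0"
    using less by (simp_all add: g_def assms(15))
  have chord: "g x = x powr \<alpha> - ((real \<Delta> powr \<alpha> - real \<delta> powr \<alpha>) / (real \<Delta> - real \<delta>) * (x - real \<delta>)
      + real \<delta> powr \<alpha>)" for x
    by (simp add: g_def assms(15))
  have upper: "general_first_zagreb \<alpha> G \<le> B"
    if ne: "num_of_degree G (\<delta> + r) \<noteq> 0" and \<alpha>: "\<alpha> < 0 \<or> \<alpha> > 1"
  proof -
    have nonpos: "g (real (d u)) \<le> 0" if "u \<in> V" for u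
      using powr_le_chord[OF \<alpha>, of "real \<delta>" "real \<Delta>" "real (d u)"] \<delta> \<Delta> that assms(14) less
      unfolding chord by force
    obtain w where w: "w \<in> V" "d w = \<delta> + r"
      using ne by (auto simp: N card_eq_0_iff)
    \<comment> \<open>Signs are flipped because \<open>member_le_sum\<close> compares one term with
      a sum of nonnegative terms.\<close>
    have "- g (real (d w)) \<le> (\<Sum>u\<in>V. - g (real (d u)))"
      using w(1) fin nonpos by (intro member_le_sum) auto
    then show ?thesis
      using zagreb w(2) by (simp add: sum_negf)
  qed
  have lower: "B \<le> general_first_zagreb \<alpha> G"
    if ne: "num_of_degree G (\<delta> + r) \<noteq> 0" and \<alpha>: "0 < \<alpha>" "\<alpha> < 1"
  proof -
    have nonneg: "0 \<le> g (real (d u))" if "u \<in> V" for u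
      using powr_ge_chord[OF \<alpha>, of "real \<delta>" "real \<Delta>" "real (d u)"] \<delta> \<Delta> that less
      unfolding chord by force
    obtain w where w: "w \<in> V" "d w = \<delta> + r"
      using ne by (auto simp: N card_eq_0_iff)
    have "g (real (d w)) \<le> (\<Sum>u\<in>V. g (real (d u)))"
      using w(1) fin nonneg by (intro member_le_sum) auto
    then show ?thesis
      using zagreb w(2) by simp
  qed
  have equality: "general_first_zagreb \<alpha> G = B"
    if "r \<ge> 1" and q: "num_of_degree G \<Delta> = q" "num_of_degree G (\<delta> + r) = 1"
      "int (num_of_degree G \<delta>) = int n - int q - 1"
  proof -
    let ?V = "\<lambda>i. {u \<in> V. d u = i}"
    \<comment> \<open>The classes are disjoint since
      \<open>\<delta> < \<delta> + r < \<Delta>\<close>, and their sizes add up to \<open>n\<close>,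
      so no other degree occurs.\<close>
    have "card (?V \<delta> \<union> ?V \<Delta> \<union> ?V (\<delta> + r)) = card (?V \<delta>) + card (?V \<Delta>) + card (?V (\<delta> + r))"
      using fin less r \<open>r \<ge> 1\<close> by (auto simp: card_Un_disjoint disjoint_iff)
    also have "\<dots> = card V"
      using q by (simp add: N assms(2) V_def)
    finally have "?V \<delta> \<union> ?V \<Delta> \<union> ?V (\<delta> + r) = V"
      using fin by (intro card_subset_eq) auto
    then have "g (real (d u)) = 0" if "u \<in> V - ?V (\<delta> + r)" for u
      using that zero by auto
    then have "(\<Sum>u\<in>V. g (real (d u))) = (\<Sum>u\<in>?V (\<delta> + r). g (real (d u)))"
      using fin by (intro sum.mono_neutral_right) auto
    also have "\<dots> = g (real (\<delta> + r))"
      using q(2) by (simp add: N)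
    finally show ?thesis
      using zagreb by simp
  qed
  show ?thesis
    unfolding B_def[symmetric]
    using part1 part2a part2b upper lower equality by (auto simp: V_def d_def)
qed

end
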